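(* Let $d\ge1$. For any sequence of non-negative numbers $\{\alpha_k\}_{k\in\mathbb{N}}$ there exist a non-negative $u_0\in L^1_0(\mathbb{R}^d)$ and a sequence $t_n\to\infty$ such that, with $$u(x,t)=\frac{1}{(4\pi t)^{d/2}}\int_{\mathbb{R}^d}e^{-|x-y|^2/4t}u_0(y)\,\mathrm{d}y,$$ for every $k$ there exists a subsequence $\{t_{k,j}\}_j$ of $\{t_n\}_n$ with $u(0,t_{k,j})\to\alpha_k$ as $j\to\infty$.
   Context: $L^1_0(\mathbb{R}^d)=\bigcap_{\varepsilon>0}L^1_\varepsilon(\mathbb{R}^d)$, where $L^1_\varepsilon(\mathbb{R}^d)=\{f\in L^1_{\rm loc}(\mathbb{R}^d):\int_{\mathbb{R}^d}e^{-\varepsilon|x|^2}|f(x)|\,\mathrm{d}x<\infty\}$. *)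

theory Defs
  imports "HOL-Analysis.Analysis"
begin

(* The spaces below consist of functions rather than of a.e. equivalence classes.  Their elements
   are Lebesgue measurable: absolute integrability on each compact set includes measurability. *)

definition L1_loc :: "(real ^ 'n \<Rightarrow> real) set" where
  "L1_loc = {f. \<forall>K. compact K \<longrightarrow> f absolutely_integrable_on K}"

definition L1_gauss :: "real \<Rightarrow> (real ^ 'n \<Rightarrow> real) set" where
  "L1_gauss \<epsilon> =
     {f \<in> L1_loc. (\<integral>\<^sup>+ x. ennreal (exp (- \<epsilon> * (norm x)\<^sup>2) * \<bar>f x\<bar>) \<partial>lebesgue) < \<infinity>}"

definition L1_zero :: "(real ^ 'n \<Rightarrow> real) set" where
  "L1_zero = (\<Inter>\<epsilon>\<in>{0<..}. L1_gauss \<epsilon>)"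

(* Meaningful for t > 0.  If u0 is in L1_zero, the integrand is Lebesgue integrable for all x and
   all t > 0, so the convention that a Bochner integral of a non-integrable function is 0 plays
   no role. *)

definition heat_sol :: "(real ^ 'n \<Rightarrow> real) \<Rightarrow> real ^ 'n \<Rightarrow> real \<Rightarrow> real" where
  "heat_sol u0 x t =
     1 / (4 * pi * t) powr (real CARD('n) / 2) *
     (LINT y|lebesgue. exp (- (norm (x - y))\<^sup>2 / (4 * t)) * u0 y)"

end

theory Submission
  imports Defs "HOL-Real_Asymp.Real_Asymp"
begin

text \<open>
  The value at the origin of a solution of the heat equation at time \<open>t\<close> sees the initial datum at
  the spatial scale \<open>sqrt t\<close>.  So an initial datum made of bumps, the \<open>m\<close>-th one living where
  \<open>norm y\<close> is comparable to \<open>sqrt (t m)\<close>, can be tuned scale by scale: the \<open>m\<close>-th bump is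
  normalised so as to contribute exactly a prescribed number \<open>\<beta> m\<close> at time \<open>t m\<close>, and if the times
  grow fast enough, it contributes next to nothing at the other times \<open>t n\<close>.

  Quantitatively (lemma \<open>bump_exists\<close>), the contribution at time \<open>s\<close> of the bump of scale \<open>t\<close> is
  at most \<open>\<beta> * heat_profile (d / 2) (t / s)\<close>, and the profile tends to \<open>0\<close> both at \<open>0\<close> and at
  infinity: for \<open>s\<close> much larger than \<open>t\<close> the bump has spread out, for \<open>s\<close> much smaller than \<open>t\<close>
  its heat has not yet reached the origin.  Lemma \<open>separated_times_exist\<close> therefore selects
  times, one after another, for which all mutual contributions are at most
  \<open>(1 / 2) ^ m * (1 / 2) ^ n\<close>.  Summing over \<open>m\<close> shows that the solution at time \<open>t n\<close> differs from
  \<open>\<beta> n\<close> by at most \<open>2 * (1 / 2) ^ n\<close> (lemma \<open>heat_sol_tracks_sequence\<close>).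

  The same estimate gives the growth condition: finiteness of the solution at the origin at
  time \<open>t n\<close> is integrability against the Gaussian with \<open>\<epsilon> = 1 / (4 * t n)\<close>, and these
  \<open>\<epsilon>\<close> tend to \<open>0\<close> (lemma \<open>L1_zeroI_heat_mass\<close>).

  Finally \<open>\<beta>\<close> is chosen to run through every \<open>\<alpha> k\<close> infinitely often.
\<close>

section \<open>The heat solution at the origin as a nonnegative integral\<close>

definition heat_kernel :: "real \<Rightarrow> real ^ 'n \<Rightarrow> real" where
  "heat_kernel t y = exp (- (norm y)\<^sup>2 / (4 * t)) / (4 * pi * t) powr (real CARD('n) / 2)"

lemma heat_kernel_nonneg [simp]: "0 \<le> heat_kernel t y"
  by (simp add: heat_kernel_def)

lemma heat_kernel_measurable [measurable]: "heat_kernel t \<in> borel_measurable lebesgue"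
  by (rule measurable_completion) (simp add: heat_kernel_def[abs_def])

text \<open>
  For nonnegative \<open>f\<close> this is the heat solution at the origin, but with values in \<open>ennreal\<close>: it
  commutes with countable sums, and its finiteness is a statement about integrability.
\<close>
definition heat_mass :: "(real ^ 'n \<Rightarrow> real) \<Rightarrow> real \<Rightarrow> ennreal" where
  "heat_mass f t = (\<integral>\<^sup>+ y. ennreal (heat_kernel t y * f y) \<partial>lebesgue)"

lemma heat_sol_eq_heat_mass:
  fixes f :: "real ^ 'n \<Rightarrow> real"
  assumes "f \<in> borel_measurable borel" and "\<And>y. 0 \<le> f y"
  shows "heat_sol f 0 t = enn2real (heat_mass f t)"
proof -
  have [measurable]: "f \<in> borel_measurable lebesgue"
    using assms(1) by (simp add: measurable_completion)
  have "heat_sol f 0 t = (LINT y|lebesgue. heat_kernel t y * f y)"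
    unfolding heat_sol_def heat_kernel_def
    by (subst integral_mult_right_zero[symmetric]) (simp add: mult.commute)
  also have "\<dots> = enn2real (heat_mass f t)"
    unfolding heat_mass_def
    by (rule integral_eq_nn_integral) (use assms in auto)
  finally show ?thesis .
qed

lemma heat_mass_suminf:
  fixes f :: "nat \<Rightarrow> real ^ 'n \<Rightarrow> real"
  assumes "\<And>m. f m \<in> borel_measurable borel" and "\<And>m y. 0 \<le> f m y"
    and "\<And>y. summable (\<lambda>m. f m y)"
  shows "heat_mass (\<lambda>y. \<Sum>m. f m y) t = (\<Sum>m. heat_mass (f m) t)"
proof -
  have [measurable]: "f m \<in> borel_measurable lebesgue" for m
    using assms(1) by (simp add: measurable_completion)
  have "heat_mass (\<lambda>y. \<Sum>m. f m y) t = (\<integral>\<^sup>+ y. (\<Sum>m. ennreal (heat_kernel t y * f m y)) \<partial>lebesgue)"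
    unfolding heat_mass_def
  proof (rule nn_integral_cong)
    fix y :: "real ^ 'n"
    have "(\<Sum>m. ennreal (heat_kernel t y * f m y)) = ennreal (\<Sum>m. heat_kernel t y * f m y)"
      using assms by (intro suminf_ennreal2 summable_mult) auto
    then show "ennreal (heat_kernel t y * (\<Sum>m. f m y)) = (\<Sum>m. ennreal (heat_kernel t y * f m y))"
      by (simp add: suminf_mult[OF assms(3)])
  qed
  also have "\<dots> = (\<Sum>m. heat_mass (f m) t)"
    unfolding heat_mass_def by (rule nn_integral_suminf) measurable
  finally show ?thesis .
qed

text \<open>
  For \<open>1 / (4 * t n) \<le> \<epsilon>\<close> the weight \<open>exp (- \<epsilon> * (norm y)\<^sup>2)\<close> is at most a constant times the heat
  kernel at time \<open>t n\<close>.  Since the \<open>t n\<close> are unbounded, this reaches every positive \<open>\<epsilon>\<close>.  Local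
  integrability follows because a Gaussian weight is bounded below on compact sets.
\<close>
lemma L1_zeroI_heat_mass:
  fixes f :: "real ^ 'n \<Rightarrow> real"
  assumes "f \<in> borel_measurable borel" and nonneg: "\<And>y. 0 \<le> f y"
    and "filterlim t at_top sequentially" and "\<And>n. 0 < t n"
    and finite_mass: "\<And>n. heat_mass f (t n) < \<infinity>"
  shows "f \<in> L1_zero"
proof -
  have [measurable]: "f \<in> borel_measurable lebesgue"
    using assms(1) by (simp add: measurable_completion)
  have [measurable]: "(\<lambda>y :: real ^ 'n. exp (- \<epsilon> * (norm y)\<^sup>2)) \<in> borel_measurable lebesgue" for \<epsilon> :: real
    by (rule measurable_completion) measurable
  have gauss_finite: "(\<integral>\<^sup>+ y. ennreal (exp (- \<epsilon> * (norm y)\<^sup>2) * \<bar>f y\<bar>) \<partial>lebesgue) < \<infinity>"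
    if "0 < \<epsilon>" for \<epsilon> :: real
  proof -
    obtain n where n: "1 / (4 * \<epsilon>) \<le> t n"
      using assms(3) by (auto simp: filterlim_at_top eventually_sequentially)
    let ?C = "(4 * pi * t n) powr (real CARD('n) / 2)"
    have Cpos: "0 < ?C" using assms(4)[of n] by simp
    have "1 / (4 * t n) \<le> \<epsilon>"
      using n assms(4)[of n] that by (simp add: field_simps)
    then have "\<epsilon> * r \<ge> r / (4 * t n)" if "0 \<le> r" for r
      using mult_right_mono[OF _ that] by fastforce
    then have "exp (- \<epsilon> * (norm y)\<^sup>2) * \<bar>f y\<bar>
        \<le> ?C * (heat_kernel (t n) y * f y)" for y
      using Cpos nonneg[of y] by (auto simp: heat_kernel_def intro!: mult_right_mono)
    then have "(\<integral>\<^sup>+ y. ennreal (exp (- \<epsilon> * (norm y)\<^sup>2) * \<bar>f y\<bar>) \<partial>lebesgue)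
        \<le> (\<integral>\<^sup>+ y. ennreal ?C * ennreal (heat_kernel (t n) y * f y) \<partial>lebesgue)"
      using Cpos nonneg
      by (intro nn_integral_mono) (simp add: ennreal_mult[symmetric] ennreal_leI)
    also have "\<dots> = ennreal ?C * heat_mass f (t n)"
      unfolding heat_mass_def by (rule nn_integral_cmult) measurable
    also have "\<dots> < \<infinity>"
      using finite_mass[of n] by (simp add: ennreal_mult_less_top)
    finally show ?thesis .
  qed
  have "f absolutely_integrable_on K" if K: "compact K" for K
  proof -
    obtain B where B: "\<And>x. x \<in> K \<Longrightarrow> norm x \<le> B"
      using compact_imp_bounded[OF K] by (auto simp: bounded_iff)
    have "integrable lebesgue (\<lambda>y. exp (- 1 * (norm y)\<^sup>2) * f y)"
    proof (rule integrableI_bounded)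
      show "(\<lambda>y. exp (- 1 * (norm y)\<^sup>2) * f y) \<in> borel_measurable lebesgue"
        by measurable
    qed (use gauss_finite[of 1] nonneg in \<open>simp add: abs_mult\<close>)
    then have "integrable lebesgue (\<lambda>y. exp (B\<^sup>2) * (exp (- 1 * (norm y)\<^sup>2) * f y))"
      by (rule integrable_mult_right)
    moreover have "K \<in> sets lebesgue"
      using K by (simp add: lmeasurable_compact fmeasurableD)
    then have "(\<lambda>y. indicator K y *\<^sub>R f y) \<in> borel_measurable lebesgue"
      by measurable
    moreover have "norm (indicator K y *\<^sub>R f y) \<le> norm (exp (B\<^sup>2) * (exp (- 1 * (norm y)\<^sup>2) * f y))" for y
    proof (cases "y \<in> K")
      case True
      have "(norm y)\<^sup>2 \<le> B\<^sup>2" using B[OF True] by (simp add: power_mono)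
      then have "1 * f y \<le> exp (B\<^sup>2 - (norm y)\<^sup>2) * f y"
        by (intro mult_right_mono nonneg) simp
      then show ?thesis
        using True nonneg[of y] by (simp add: abs_mult exp_diff exp_minus field_simps)
    qed simp
    ultimately show ?thesis
      unfolding set_integrable_def by (rule Bochner_Integration.integrable_bound[OF _ _ AE_I2])
  qed
  then show ?thesis
    using gauss_finite by (simp add: L1_zero_def L1_gauss_def L1_loc_def)
qed

section \<open>A bump at a single scale\<close>

text \<open>
  An upper bound, as a function of \<open>x = t / s\<close>, for the heat at the origin at time \<open>s\<close> coming from a
  bump at distance between \<open>sqrt t\<close> and \<open>3 * sqrt t\<close> that yields the value \<open>1\<close> at time \<open>t\<close>; here
  \<open>p\<close> is half the dimension.  The power is the ratio of the normalising factors of the kernels,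
  the exponential comes from their Gaussian factors.
\<close>
definition heat_profile :: "real \<Rightarrow> real \<Rightarrow> real" where
  "heat_profile p x = x powr p * exp (9 / 4 - x / 4)"

lemma heat_profile_at_top:
  assumes "0 < p"
  shows "(heat_profile p \<longlongrightarrow> 0) at_top"
  unfolding heat_profile_def using assms by real_asymp

lemma heat_profile_at_right_0:
  assumes "0 < p"
  shows "(heat_profile p \<longlongrightarrow> 0) (at_right 0)"
  unfolding heat_profile_def using assms by real_asymp

text \<open>
  The bump is supported on a ball \<open>B\<close> contained in the shell \<open>sqrt t \<le> norm y \<le> 3 * sqrt t\<close>.  On \<open>B\<close>
  it is a multiple of the reciprocal of the heat kernel at time \<open>t\<close>, so that the integrand at
  time \<open>t\<close> is constant on \<open>B\<close> and no Gaussian integral has to be evaluated.  At another time \<open>s\<close> the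
  integrand is this constant times the quotient of the two kernels, which is bounded on the shell.
\<close>
lemma bump_exists:
  fixes \<beta> t :: real
  assumes "0 \<le> \<beta>" and "0 < t"
  obtains f :: "real ^ 'n \<Rightarrow> real"
  where "f \<in> borel_measurable borel" and "\<And>y. 0 \<le> f y"
    and "\<And>y. norm y < sqrt t \<Longrightarrow> f y = 0"
    and "heat_mass f t = ennreal \<beta>"
    and "\<And>s. 0 < s \<Longrightarrow> heat_mass f s \<le> ennreal (\<beta> * heat_profile (real CARD('n) / 2) (t / s))"
proof -
  obtain a :: "real ^ 'n" where a: "norm a = 2 * sqrt t"
    using assms(2) vector_choose_size[of "2 * sqrt t"] by auto
  define p where "p = real CARD('n) / 2"
  define B where "B = ball a (sqrt t)"
  define v where "v = measure lebesgue B"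
  have v: "0 < v" and B_sets: "B \<in> sets lebesgue" and B_emeasure: "emeasure lebesgue B = ennreal v"
    using assms(2) by (simp_all add: v_def B_def content_ball_pos emeasure_eq_measure2 lmeasurable_ball)
  have shell: "sqrt t \<le> norm y" "norm y \<le> 3 * sqrt t" if "y \<in> B" for y
  proof -
    have "norm (a - y) < sqrt t" using that by (simp add: B_def dist_norm)
    then show "sqrt t \<le> norm y" "norm y \<le> 3 * sqrt t"
      using a norm_triangle_ineq2[of a y] norm_triangle_ineq2[of y a] by (auto simp: norm_minus_commute)
  qed
  have shell_sq: "t \<le> (norm y)\<^sup>2" "(norm y)\<^sup>2 \<le> 9 * t" if "y \<in> B" for y
    using power_mono[OF shell(1)[OF that], of 2] power_mono[OF shell(2)[OF that], of 2] assms(2)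
    by (simp_all add: power_mult_distrib)
  define f :: "real ^ 'n \<Rightarrow> real" where
    "f = (\<lambda>y. \<beta> * (4 * pi * t) powr p / v * exp ((norm y)\<^sup>2 / (4 * t)) * indicator B y)"
  have const: "(\<integral>\<^sup>+ y. ennreal (c / v * indicator B y) \<partial>lebesgue) = ennreal c" if "0 \<le> c" for c
  proof -
    have "(\<integral>\<^sup>+ y. ennreal (c / v * indicator B y) \<partial>lebesgue)
        = (\<integral>\<^sup>+ y. ennreal (c / v) * indicator B y \<partial>lebesgue)"
      by (intro nn_integral_cong) (simp add: indicator_def)
    also have "\<dots> = ennreal (c / v) * ennreal v"
      using B_sets by (simp add: nn_integral_cmult_indicator B_emeasure)
    also have "\<dots> = ennreal c"
      using v that by (simp add: ennreal_mult[symmetric])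
    finally show ?thesis .
  qed
  show thesis
  proof
    have "B \<in> sets borel" by (simp add: B_def)
    then show "f \<in> borel_measurable borel" unfolding f_def by measurable
    show "0 \<le> f y" for y using assms v by (simp add: f_def)
    show "f y = 0" if "norm y < sqrt t" for y
      using that shell(1)[of y] by (auto simp: f_def indicator_def)
    have "heat_kernel t y * f y = \<beta> / v * indicator B y" for y
      using assms(2) by (simp add: heat_kernel_def p_def f_def exp_minus field_simps)
    then show "heat_mass f t = ennreal \<beta>"
      unfolding heat_mass_def using const[OF assms(1)] by simp
    fix s :: real assume s: "0 < s"
    let ?c = "\<beta> * heat_profile p (t / s)"
    have "heat_kernel s y * f y \<le> ?c / v * indicator B y" for y
    proof (cases "y \<in> B")
      case True
      have "- (norm y)\<^sup>2 / (4 * s) + (norm y)\<^sup>2 / (4 * t) \<le> - t / (4 * s) + 9 * t / (4 * t)"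
        using shell_sq[OF True] s assms(2) by (intro add_mono divide_right_mono) auto
      then have "- (norm y)\<^sup>2 / (4 * s) + (norm y)\<^sup>2 / (4 * t) \<le> 9 / 4 - t / s / 4"
        using s assms(2) by (simp add: field_simps)
      then have "exp (- (norm y)\<^sup>2 / (4 * s)) * exp ((norm y)\<^sup>2 / (4 * t)) \<le> exp (9 / 4 - t / s / 4)"
        by (simp add: exp_add[symmetric])
      moreover have powr_ratio: "(t / s) powr p = (4 * pi * t) powr p / (4 * pi * s) powr p"
        using s assms(2) by (simp add: powr_divide[symmetric])
      have "heat_kernel s y * f y
          = \<beta> / v * (t / s) powr p * (exp (- (norm y)\<^sup>2 / (4 * s)) * exp ((norm y)\<^sup>2 / (4 * t)))"
        unfolding powr_ratio using True by (simp add: heat_kernel_def p_def f_def field_simps)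
      moreover have "0 \<le> \<beta> / v * (t / s) powr p" using assms v by simp
      ultimately have "heat_kernel s y * f y
          \<le> \<beta> / v * (t / s) powr p * exp (9 / 4 - t / s / 4)"
        by (metis mult_left_mono)
      then show ?thesis using True by (simp add: heat_profile_def)
    qed (simp add: f_def)
    then have "heat_mass f s \<le> (\<integral>\<^sup>+ y. ennreal (?c / v * indicator B y) \<partial>lebesgue)"
      unfolding heat_mass_def by (intro nn_integral_mono ennreal_leI)
    also have "\<dots> = ennreal ?c"
      using assms(1) by (intro const) (simp add: heat_profile_def)
    finally show "heat_mass f s \<le> ennreal (\<beta> * heat_profile (real CARD('n) / 2) (t / s))"
      by (simp add: p_def)
  qed
qed

section \<open>Superposition of bumps at separated scales\<close>

text \<open>
  Given the earlier times, both kinds of interaction of a new time \<open>r\<close> with each of them tend to \<open>0\<close>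
  as \<open>r\<close> grows: \<open>t m / r\<close> tends to \<open>0\<close> from the right and \<open>r / t m\<close> to infinity.  The number \<open>\<beta> n\<close>
  is fixed while \<open>r\<close> varies, so even a fast growing \<open>\<beta>\<close> is compensated by a large \<open>r\<close>.
\<close>
lemma separated_times_exist:
  fixes \<phi> :: "real \<Rightarrow> real" and \<beta> :: "nat \<Rightarrow> real"
  assumes "(\<phi> \<longlongrightarrow> 0) at_top" and "(\<phi> \<longlongrightarrow> 0) (at_right 0)"
  obtains t :: "nat \<Rightarrow> real"
  where "\<And>n. real n + 1 \<le> t n"
    and "\<And>m n. m \<noteq> n \<Longrightarrow> \<beta> m * \<phi> (t m / t n) \<le> (1 / 2) ^ m * (1 / 2) ^ n"
proof -
  let ?e = "\<lambda>m n. (1 / 2) ^ m * (1 / 2) ^ n :: real"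
  define P where "P = (\<lambda>t n r. real n + 1 \<le> r \<and>
      (\<forall>m<n. \<beta> m * \<phi> (t m / r) \<le> ?e m n \<and> \<beta> n * \<phi> (r / t m) \<le> ?e m n))"
  have "\<exists>t. \<forall>n. P t n (t n)"
  proof (rule dependent_wellorder_choice)
    show "P t n r = P t' n r" if "\<And>m. m < n \<Longrightarrow> t m = t' m" for r t t' n
      using that by (simp add: P_def)
    fix n :: nat and t :: "nat \<Rightarrow> real"
    assume prev: "\<And>m. m < n \<Longrightarrow> P t m (t m)"
    have "\<forall>\<^sub>F r in at_top. \<beta> m * \<phi> (t m / r) \<le> ?e m n \<and> \<beta> n * \<phi> (r / t m) \<le> ?e m n" if "m < n" for m
    proof -
      have tm: "0 < t m" using prev[OF that] by (simp add: P_def)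
      have "((\<lambda>r. \<beta> m * \<phi> (t m / r)) \<longlongrightarrow> \<beta> m * 0) at_top"
        using tm by (intro tendsto_mult tendsto_const filterlim_compose[OF assms(2)]) real_asymp
      moreover have "((\<lambda>r. \<beta> n * \<phi> (r / t m)) \<longlongrightarrow> \<beta> n * 0) at_top"
        using tm by (intro tendsto_mult tendsto_const filterlim_compose[OF assms(1)]) real_asymp
      ultimately have "\<forall>\<^sub>F r in at_top. \<beta> m * \<phi> (t m / r) < ?e m n"
        "\<forall>\<^sub>F r in at_top. \<beta> n * \<phi> (r / t m) < ?e m n"
        by (auto intro: order_tendstoD(2))
      then show ?thesis by eventually_elim auto
    qed
    then have "\<forall>\<^sub>F r in at_top. \<forall>m\<in>{..<n}. \<beta> m * \<phi> (t m / r) \<le> ?e m n \<and> \<beta> n * \<phi> (r / t m) \<le> ?e m n"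
      by (intro eventually_ball_finite) auto
    then have "\<forall>\<^sub>F r in at_top. P t n r"
      using eventually_ge_at_top[of "real n + 1"] by eventually_elim (auto simp: P_def)
    then show "\<exists>r. P t n r" by (rule eventually_happens'[rotated]) simp
  qed
  then obtain t where t: "\<And>n. P t n (t n)" by blast
  show thesis
  proof
    show "real n + 1 \<le> t n" for n using t[of n] by (simp add: P_def)
    show "\<beta> m * \<phi> (t m / t n) \<le> ?e m n" if "m \<noteq> n" for m n
      using that t[of n] t[of m] by (cases m n rule: linorder_cases) (auto simp: P_def mult.commute)
  qed
qed

text \<open>
  The \<open>n\<close>-th bump alone gives the lower bound \<open>\<beta> n\<close>, since all bumps are nonnegative; the other bumps
  add at most \<open>\<Sum>m. (1 / 2) ^ m * (1 / 2) ^ n\<close>.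
\<close>
lemma heat_sol_tracks_sequence:
  fixes \<beta> :: "nat \<Rightarrow> real"
  assumes "\<And>n. 0 \<le> \<beta> n"
  obtains u0 :: "real ^ 'n \<Rightarrow> real" and t :: "nat \<Rightarrow> real"
  where "u0 \<in> L1_zero" and "\<And>x. 0 \<le> u0 x"
    and "\<And>n. 0 < t n" and "filterlim t at_top sequentially"
    and "(\<lambda>n. heat_sol u0 0 (t n) - \<beta> n) \<longlonglongrightarrow> 0"
proof -
  define \<phi> where "\<phi> = heat_profile (real CARD('n) / 2)"
  have "(\<phi> \<longlongrightarrow> 0) at_top" "(\<phi> \<longlongrightarrow> 0) (at_right 0)"
    by (simp_all add: \<phi>_def heat_profile_at_top heat_profile_at_right_0)
  then obtain t where t_ge: "\<And>n. real n + 1 \<le> t n"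
    and sep: "\<And>m n. m \<noteq> n \<Longrightarrow> \<beta> m * \<phi> (t m / t n) \<le> (1 / 2) ^ m * (1 / 2) ^ n"
    using separated_times_exist[of \<phi> \<beta>] by blast
  have t_pos: "0 < t n" for n using t_ge[of n] by linarith
  have t_lim: "filterlim t at_top sequentially"
    by (rule filterlim_at_top_mono[OF filterlim_real_sequentially])
       (use t_ge in \<open>auto intro!: always_eventually order_trans[OF _ t_ge]\<close>)
  have "\<exists>f :: real ^ 'n \<Rightarrow> real. f \<in> borel_measurable borel \<and> (\<forall>y. 0 \<le> f y) \<and>
      (\<forall>y. norm y < sqrt (t m) \<longrightarrow> f y = 0) \<and> heat_mass f (t m) = ennreal (\<beta> m) \<and>
      (\<forall>s>0. heat_mass f s \<le> ennreal (\<beta> m * \<phi> (t m / s)))" for m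
    by (rule bump_exists[OF assms[of m] t_pos[of m]]) (auto simp: \<phi>_def)
  then obtain f :: "nat \<Rightarrow> real ^ 'n \<Rightarrow> real" where
    f_meas: "\<And>m. f m \<in> borel_measurable borel" and f_nonneg: "\<And>m y. 0 \<le> f m y" and
    f_supp: "\<And>m y. norm y < sqrt (t m) \<Longrightarrow> f m y = 0" and
    f_diag: "\<And>m. heat_mass (f m) (t m) = ennreal (\<beta> m)" and
    f_off: "\<And>m s. 0 < s \<Longrightarrow> heat_mass (f m) s \<le> ennreal (\<beta> m * \<phi> (t m / s))"
    by metis
  define u0 where "u0 = (\<lambda>y. \<Sum>m. f m y)"
  \<comment> \<open>At any given point only finitely many bumps are nonzero.\<close>
  have summ: "summable (\<lambda>m. f m y)" for y
  proof (rule summable_finite)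
    show "finite {m. sqrt (t m) \<le> norm y}"
    proof (rule finite_subset)
      show "{m. sqrt (t m) \<le> norm y} \<subseteq> {m. real m \<le> (norm y)\<^sup>2}"
      proof clarify
        fix m assume "sqrt (t m) \<le> norm y"
        then have "t m \<le> (norm y)\<^sup>2" by (simp add: sqrt_le_D)
        then show "real m \<le> (norm y)\<^sup>2" using t_ge[of m] by linarith
      qed
      have "{m. real m \<le> (norm y)\<^sup>2} \<subseteq> {..nat \<lfloor>(norm y)\<^sup>2\<rfloor>}"
        by (auto simp: le_nat_floor)
      then show "finite {m. real m \<le> (norm y)\<^sup>2}" using finite_subset by blast
    qed
    show "f m y = 0" if "m \<notin> {m. sqrt (t m) \<le> norm y}" for m
      using that f_supp by simp
  qed
  have u0_meas: "u0 \<in> borel_measurable borel"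
    unfolding u0_def using f_meas by measurable
  have u0_nonneg: "0 \<le> u0 y" for y
    unfolding u0_def using f_nonneg summ by (simp add: suminf_nonneg)
  have mass: "heat_mass u0 s = (\<Sum>m. heat_mass (f m) s)" for s
    unfolding u0_def by (rule heat_mass_suminf) (use f_meas f_nonneg summ in auto)
  have upper: "heat_mass u0 (t n) \<le> ennreal (\<beta> n + 2 * (1 / 2) ^ n)" for n
  proof -
    \<comment> \<open>The interaction bound is also added on the diagonal, to make it a full geometric series.\<close>
    let ?b = "\<lambda>m. (if m = n then \<beta> n else 0) + (1 / 2) ^ m * (1 / 2) ^ n :: real"
    have "(\<lambda>m. (1 / 2) ^ m * (1 / 2) ^ n) sums (2 * (1 / 2) ^ n :: real)"
      using sums_mult2[OF geometric_sums[of "1 / 2 :: real"], of "(1 / 2) ^ n"] by simp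
    then have b: "?b sums (\<beta> n + 2 * (1 / 2) ^ n)"
      by (intro sums_add sums_single)
    have "heat_mass (f m) (t n) \<le> ennreal (?b m)" for m
    proof (cases "m = n")
      case True
      then show ?thesis by (simp add: f_diag ennreal_leI)
    next
      case False
      then show ?thesis
        using order_trans[OF f_off[OF t_pos] ennreal_leI[OF sep]] by simp
    qed
    then have "heat_mass u0 (t n) \<le> (\<Sum>m. ennreal (?b m))"
      unfolding mass by (intro suminf_le) auto
    also have "\<dots> = ennreal (\<Sum>m. ?b m)"
      using b assms by (intro suminf_ennreal2) (auto simp: sums_iff)
    finally show ?thesis using b by (simp add: sums_iff)
  qed
  have lower: "ennreal (\<beta> n) \<le> heat_mass u0 (t n)" for n
    using sum_le_suminf[of "\<lambda>m. heat_mass (f m) (t n)" "{n}"] by (simp add: mass f_diag)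
  have bounds: "\<beta> n \<le> heat_sol u0 0 (t n)" "heat_sol u0 0 (t n) \<le> \<beta> n + 2 * (1 / 2) ^ n" for n
  proof -
    have nonneg: "0 \<le> \<beta> n + 2 * (1 / 2) ^ n" using assms[of n] by simp
    have fin: "heat_mass u0 (t n) < top" using upper[of n] le_less_trans by fastforce
    have eq: "heat_sol u0 0 (t n) = enn2real (heat_mass u0 (t n))"
      by (rule heat_sol_eq_heat_mass) (use u0_meas u0_nonneg in auto)
    show "\<beta> n \<le> heat_sol u0 0 (t n)"
      using enn2real_mono[OF lower fin] assms by (simp add: eq)
    show "heat_sol u0 0 (t n) \<le> \<beta> n + 2 * (1 / 2) ^ n"
      using enn2real_mono[OF upper[of n]] nonneg by (simp add: eq)
  qed
  show thesis
  proof
    show "u0 \<in> L1_zero"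
      using u0_meas u0_nonneg t_lim t_pos
    proof (rule L1_zeroI_heat_mass)
      show "heat_mass u0 (t n) < \<infinity>" for n using upper[of n] le_less_trans by fastforce
    qed
    show "(\<lambda>n. heat_sol u0 0 (t n) - \<beta> n) \<longlonglongrightarrow> 0"
    proof (rule tendsto_sandwich[of "\<lambda>_. 0" _ _ "\<lambda>n. 2 * (1 / 2) ^ n"])
      show "(\<lambda>n. 2 * (1 / 2) ^ n :: real) \<longlonglongrightarrow> 0" by real_asymp
    qed (use bounds in \<open>auto simp: algebra_simps\<close>)
  qed (use u0_nonneg t_pos t_lim in auto)
qed

theorem theorem6p3:
  fixes \<alpha> :: "nat \<Rightarrow> real"
  assumes "\<And>k. 0 \<le> \<alpha> k"
  shows "\<exists>(u0 :: real ^ 'n \<Rightarrow> real) (t :: nat \<Rightarrow> real).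
           u0 \<in> L1_zero \<and> (\<forall>x. 0 \<le> u0 x) \<and>
           (\<forall>n. 0 < t n) \<and> filterlim t at_top sequentially \<and>
           (\<forall>k. \<exists>r :: nat \<Rightarrow> nat. strict_mono r \<and>
                  (\<lambda>j. heat_sol u0 0 (t (r j))) \<longlonglongrightarrow> \<alpha> k)"
proof -
  \<comment> \<open>The pairs \<open>(k, j)\<close> for fixed \<open>k\<close> make \<open>\<beta>\<close> take the value \<open>\<alpha> k\<close> infinitely often.\<close>
  define \<beta> where "\<beta> = (\<lambda>n. \<alpha> (fst (prod_decode n)))"
  obtain u0 :: "real ^ 'n \<Rightarrow> real" and t where
    u0: "u0 \<in> L1_zero" "\<And>x. 0 \<le> u0 x" "\<And>n. 0 < t n" "filterlim t at_top sequentially" and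
    track: "(\<lambda>n. heat_sol u0 0 (t n) - \<beta> n) \<longlonglongrightarrow> 0"
    using heat_sol_tracks_sequence[of \<beta>] assms by (auto simp: \<beta>_def)
  have "\<exists>r :: nat \<Rightarrow> nat. strict_mono r \<and> (\<lambda>j. heat_sol u0 0 (t (r j))) \<longlonglongrightarrow> \<alpha> k" for k
  proof (intro exI conjI)
    let ?r = "\<lambda>j. prod_encode (k, j)"
    show r: "strict_mono ?r"
      by (simp add: strict_mono_Suc_iff prod_encode_def)
    have "(\<lambda>j. heat_sol u0 0 (t (?r j)) - \<alpha> k) \<longlonglongrightarrow> 0"
      using LIMSEQ_subseq_LIMSEQ[OF track r] by (simp add: o_def \<beta>_def)
    then show "(\<lambda>j. heat_sol u0 0 (t (?r j))) \<longlonglongrightarrow> \<alpha> k"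
      by (simp add: LIM_zero_iff)
  qed
  then show ?thesis using u0 by blast
qed

end
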